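(* Let $\Omega\subset\mathbb R^n$ be open and convex and let $T=\mathbb R^n+i\Omega\subset\mathbb C^n$. A function $f\in\mathcal O(T)$ is holomorphic almost periodic if and only if $f\in\mathcal O_{AP}(T)$, where $AP=AP(\mathbb Z^n)$.
   Context: A function $f\in\mathcal O(T)$ is called holomorphic almost periodic (Bochner's definition) if the family of its translates $\{z\mapsto f(z+s),\ z\in T\}_{s\in\mathbb R^n}$ is relatively compact in the topology of uniform convergence on tube subdomains $T'=\mathbb R^n+i\Omega'$, $\Omega'\Subset\Omega$ (relatively compact). Let $p(z):=(e^{iz_1},\dots,e^{iz_n})$, $z=(z_1,\dots,z_n)\in T$, and $T_0:=p(T)\subset\mathbb C^n$. Then $p:T\to T_0$ is a regular covering with deck transformation group $\mathbb Z^n$, where $g\in\mathbb Z^n$ acts by $g\cdot z=z+2\pi g$. $AP(\mathbb Z^n)$ is the algebra of almost periodic functions on $\mathbb Z^n$: bounded functions $u:\mathbb Z^n\to\mathbb C$ such that the family of translates $\{t\mapsto u(t+s)\}_{s\in\mathbb Z^n}$ is relatively compact in $\ell_\infty(\mathbb Z^n)$ (bounded complex functions with sup-norm). $\mathcal O_{AP}(T)$ is the set of functions $f\in\mathcal O(T)$ such that (1) $f$ is bounded on $p^{-1}(U_0)$ for every $U_0\Subset T_0$, and (2) for each $z\in T$ the function $\mathbb Z^n\ni g\mapsto f(g\cdot z)$ belongs to $AP(\mathbb Z^n)$. *)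

theory Defs
  imports "HOL-Analysis.Analysis"
begin

definition relatively_compactin :: "'a topology \<Rightarrow> 'a set \<Rightarrow> bool" where
  "relatively_compactin X S \<longleftrightarrow> S \<subseteq> topspace X \<and> compactin X (X closure_of S)"

definition tube :: "(real ^ 'n) set \<Rightarrow> (complex ^ 'n) set" where
  "tube \<Omega> = {\<chi> j. Complex (x $ j) (y $ j) | x y. y \<in> \<Omega>}"

text \<open>Holomorphic functions on an open subset of complex n-space: the (real) Frechet derivative
  exists at every point and is complex linear.  A function on \<open>S\<close> is represented by its extension
  by \<open>undefined\<close> outside \<open>S\<close>, so that equality of elements of this set is equality on \<open>S\<close>.\<close>

definition holomorphic_funs :: "(complex ^ 'n) set \<Rightarrow> (complex ^ 'n \<Rightarrow> complex) set" where
  "holomorphic_funs S = {f \<in> extensional S.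
     \<forall>z\<in>S. \<exists>D. (f has_derivative D) (at z) \<and> (\<forall>c v. D (c *s v) = c * D v)}"

text \<open>The topology on the holomorphic functions on \<open>T = tube \<Omega>\<close> of uniform convergence on the tubes
  over relatively compact subdomains of \<open>\<Omega>\<close>.  Holomorphic functions may be unbounded on such a
  tube, whence the extended reals; the balls have to be taken with respect to the supremum, since
  the sets defined by the pointwise strict inequality are not open for uniform convergence.\<close>

definition tube_topology :: "(real ^ 'n) set \<Rightarrow> (complex ^ 'n \<Rightarrow> complex) topology" where
  "tube_topology \<Omega> = topology_generated_by
     {{g \<in> holomorphic_funs (tube \<Omega>). (SUP z\<in>tube \<Omega>'. ereal (dist (f z) (g z))) < ereal \<epsilon>} | f \<Omega>' \<epsilon>.
        f \<in> holomorphic_funs (tube \<Omega>) \<and> \<epsilon> > 0 \<and>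
        open \<Omega>' \<and> connected \<Omega>' \<and> relatively_compactin (top_of_set \<Omega>) \<Omega>'}"

lemma topspace_tube_topology: "topspace (tube_topology \<Omega>) = holomorphic_funs (tube \<Omega>)"
proof -
  have "f \<in> topspace (tube_topology \<Omega>)" if "f \<in> holomorphic_funs (tube \<Omega>)" for f
  proof -
    have "f \<in> {g \<in> holomorphic_funs (tube \<Omega>). (SUP z\<in>tube {}. ereal (dist (f z) (g z))) < ereal 1}"
      using that by (simp add: tube_def bot_ereal_def)
    moreover have "relatively_compactin (top_of_set \<Omega>) {}"
      by (simp add: relatively_compactin_def)
    ultimately show ?thesis
      using that zero_less_one open_empty connected_empty
      unfolding tube_topology_def topology_generated_by_topspace by blast
  qed
  then show ?thesis
    unfolding tube_topology_def topology_generated_by_topspace by blast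
qed

definition real_shift :: "real ^ 'n \<Rightarrow> complex ^ 'n \<Rightarrow> complex ^ 'n" where
  "real_shift s z = (\<chi> j. z $ j + of_real (s $ j))"

definition holomorphic_almost_periodic ::
    "(real ^ 'n) set \<Rightarrow> (complex ^ 'n \<Rightarrow> complex) \<Rightarrow> bool" where
  "holomorphic_almost_periodic \<Omega> f \<longleftrightarrow>
     f \<in> holomorphic_funs (tube \<Omega>) \<and>
     relatively_compactin (tube_topology \<Omega>)
       (range (\<lambda>s. restrict (\<lambda>z. f (real_shift s z)) (tube \<Omega>)))"

definition exp_covering :: "complex ^ 'n \<Rightarrow> complex ^ 'n" where
  "exp_covering z = (\<chi> j. exp (\<i> * z $ j))"

definition deck_action :: "int ^ 'n \<Rightarrow> complex ^ 'n \<Rightarrow> complex ^ 'n" where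
  "deck_action g z = (\<chi> j. z $ j + 2 * of_real pi * of_int (g $ j))"

text \<open>The bounded complex functions on the n-dimensional integer lattice with the metric
  of the supremum norm.\<close>

definition linf_topology :: "(int ^ 'n \<Rightarrow> complex) topology" where
  "linf_topology = Metric_space.mtopology (Met_TC.fspace UNIV) (Met_TC.fdist UNIV)"

definition AP_Zn :: "(int ^ 'n \<Rightarrow> complex) set" where
  "AP_Zn = {u. bounded (range u) \<and> relatively_compactin linf_topology (range (\<lambda>s t. u (t + s)))}"

definition holomorphic_AP :: "(real ^ 'n) set \<Rightarrow> (complex ^ 'n \<Rightarrow> complex) set" where
  "holomorphic_AP \<Omega> = {f \<in> holomorphic_funs (tube \<Omega>).
     (\<forall>U\<^sub>0. relatively_compactin (top_of_set (exp_covering ` tube \<Omega>)) U\<^sub>0 \<longrightarrow>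
        bounded (f ` {z \<in> tube \<Omega>. exp_covering z \<in> U\<^sub>0})) \<and>
     (\<forall>z\<in>tube \<Omega>. (\<lambda>g. f (deck_action g z)) \<in> AP_Zn)}"

end

theory Submission
  imports Defs "HOL-Complex_Analysis.Cauchy_Integral_Formula"
begin

text \<open>A countable exhaustion of \<open>\<Omega>\<close> turns uniform convergence on tubes into a complete metric, so
  almost periodicity of \<open>f\<close> becomes total boundedness: over each compact \<open>K \<subseteq> \<Omega>\<close>, finitely many
  real translates of \<open>f\<close> approximate all others uniformly. Membership in \<open>AP_Zn\<close> is the same condition
  for lattice translates of a sequence. One direction is then restriction to the orbit of a point.
  Conversely, boundedness on tubes and Cauchy's estimate make \<open>f\<close> uniformly continuous on tubes.
  A tube over \<open>K\<close> is covered by lattice translates of a compact cell, so almost periodicity on the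
  orbits of finitely many points of the cell gives a finite net for the lattice translates, and a
  finite net of a period cell extends it to all real translates.\<close>

section \<open>Cauchy estimates in several variables\<close>

definition complex_differentiable_at :: "(complex ^ 'n \<Rightarrow> complex) \<Rightarrow> complex ^ 'n \<Rightarrow> bool" where
  "complex_differentiable_at f z \<longleftrightarrow>
     (\<exists>D. (f has_derivative D) (at z) \<and> (\<forall>c v. D (c *s v) = c * D v))"

lemma holomorphic_funs_iff:
  "f \<in> holomorphic_funs S \<longleftrightarrow> f \<in> extensional S \<and> (\<forall>z\<in>S. complex_differentiable_at f z)"
  by (simp add: holomorphic_funs_def complex_differentiable_at_def)

lemma frechet_derivative_complex:
  assumes "complex_differentiable_at f z"
  shows "(f has_derivative frechet_derivative f (at z)) (at z)"
    and "frechet_derivative f (at z) (c *s v) = c * frechet_derivative f (at z) v"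
  using assms frechet_derivative_at unfolding complex_differentiable_at_def by metis+

lemma complex_differentiable_at_diff:
  assumes "complex_differentiable_at f z" "complex_differentiable_at g z"
  shows "complex_differentiable_at (\<lambda>z. f z - g z) z"
proof -
  obtain D E where "(f has_derivative D) (at z)" "\<forall>c v. D (c *s v) = c * D v"
    "(g has_derivative E) (at z)" "\<forall>c v. E (c *s v) = c * E v"
    using assms unfolding complex_differentiable_at_def by blast
  then show ?thesis
    unfolding complex_differentiable_at_def
    by (intro exI[of _ "\<lambda>v. D v - E v"]) (auto intro: has_derivative_diff simp: algebra_simps)
qed

lemma norm_vector_scalar_mult: "norm (c *s v) = norm c * norm v" for v :: "complex ^ 'n"
  by (simp add: norm_vec_def norm_mult L2_set_right_distrib)

lemma bounded_linear_vector_scalar_mult: "bounded_linear (\<lambda>c. c *s v)" for v :: "complex ^ 'n"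
  by (rule bounded_linear_intro[of _ "norm v"])
     (simp_all add: norm_vector_scalar_mult vector_sadd_rdistrib vec_eq_iff)

text \<open>Complex linearity turns the chain-rule derivative \<open>h \<mapsto> D (h *s v)\<close>
  into multiplication by the number \<open>D v\<close>, so one-variable theory applies on complex
  lines.\<close>

lemma complex_differentiable_at_slice:
  fixes f :: "complex ^ 'n \<Rightarrow> complex"
  assumes "(f has_derivative D) (at (z + l *s v))" "\<And>c v. D (c *s v) = c * D v"
  shows "((\<lambda>l. f (z + l *s v)) has_field_derivative D v) (at l)"
proof -
  have "((\<lambda>l. z + l *s v) has_derivative (\<lambda>h. h *s v)) (at l)"
    using has_derivative_add[OF has_derivative_const
        bounded_linear_imp_has_derivative[OF bounded_linear_vector_scalar_mult]] by simp
  from has_derivative_compose[OF this assms(1)]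
  have "((\<lambda>l. f (z + l *s v)) has_derivative (\<lambda>h. h * D v)) (at l)"
    by (simp only: assms(2))
  moreover have "(\<lambda>h. h * D v) = (*) (D v)"
    by (simp add: fun_eq_iff)
  ultimately show ?thesis
    by (simp only: has_field_derivative_def)
qed

text \<open>On the complex line through \<open>z\<close> in direction \<open>v\<close>, this is the
  one-variable Cauchy inequality for the first derivative at 0.\<close>

lemma Cauchy_estimate_vec:
  fixes f :: "complex ^ 'n \<Rightarrow> complex"
  assumes r: "0 < r" and dif: "\<And>w. w \<in> ball z r \<Longrightarrow> complex_differentiable_at f w"
    and M: "\<And>w. w \<in> ball z r \<Longrightarrow> norm (f w) \<le> M"
    and D: "(f has_derivative D) (at z)" "\<And>c v. D (c *s v) = c * D v"
  shows "norm (D v) \<le> 2 * M / r * norm v"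
proof (cases "v = 0")
  case True
  then show ?thesis
    using linear_0[OF has_derivative_linear[OF D(1)]] by simp
next
  case False
  \<comment> \<open>This disc is mapped into the closed ball of radius \<open>r / 2\<close>, hence
    stays inside the open ball up to its boundary; that costs the factor 2.\<close>
  define \<rho> where "\<rho> = r / (2 * norm v)"
  have \<rho>: "\<rho> > 0" "\<rho> * norm v < r"
    using r False by (auto simp: \<rho>_def)
  have in_ball: "z + l *s v \<in> ball z r" if "norm l \<le> \<rho>" for l
  proof -
    have "norm l * norm v \<le> \<rho> * norm v"
      using that by (simp add: mult_right_mono)
    then show ?thesis
      using \<rho> by (simp add: dist_norm norm_vector_scalar_mult)
  qed
  define \<phi> where "\<phi> = (\<lambda>l. f (z + l *s v))"
  have "\<exists>D. (\<phi> has_field_derivative D) (at l)" if "norm l \<le> \<rho>" for l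
    using dif[OF in_ball[OF that]] complex_differentiable_at_slice
    unfolding complex_differentiable_at_def \<phi>_def by blast
  then have \<phi>: "\<phi> field_differentiable (at l)" if "norm l \<le> \<rho>" for l
    using that by (simp add: field_differentiable_def)
  have "norm ((deriv ^^ 1) \<phi> 0) \<le> fact 1 * M / \<rho> ^ 1"
  proof (rule Cauchy_inequality)
    show "\<phi> holomorphic_on ball 0 \<rho>"
      using \<phi> by (auto simp: holomorphic_on_def intro: field_differentiable_at_within)
    show "continuous_on (cball 0 \<rho>) \<phi>"
      using \<phi> by (intro continuous_at_imp_continuous_on)
        (auto intro: field_differentiable_imp_continuous_at)
    show "norm (\<phi> x) \<le> M" if "norm (0 - x) = \<rho>" for x
      using M[OF in_ball, of x] that by (simp add: \<phi>_def)
  qed (fact \<rho>)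
  moreover have "deriv \<phi> 0 = D v"
    unfolding \<phi>_def
    by (rule DERIV_imp_deriv, rule complex_differentiable_at_slice) (use D in simp_all)
  ultimately show ?thesis
    by (simp add: \<rho>_def mult_ac)
qed

text \<open>Weierstrass' theorem. Cauchy's estimate for the differences \<open>f m - f n\<close>
  makes the derivatives uniformly Cauchy on the half ball, so the limit may be differentiated
  termwise; complex linearity passes to the limit pointwise.\<close>

lemma complex_differentiable_at_uniform_limit:
  fixes f :: "nat \<Rightarrow> complex ^ 'n \<Rightarrow> complex"
  assumes r: "0 < r" and dif: "\<And>n w. w \<in> ball z r \<Longrightarrow> complex_differentiable_at (f n) w"
    and lim: "uniform_limit (ball z r) f h sequentially"
  shows "complex_differentiable_at h z"
proof -
  define S where "S = ball z (r / 2)"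
  have S: "ball x (r / 2) \<subseteq> ball z r" if "x \<in> S" for x
    using that by (simp add: S_def dist_commute ball_subset_ball_iff)
  have S_in: "x \<in> ball z r" if "x \<in> S" for x
    using that r by (simp add: S_def)
  define D where "D n x = frechet_derivative (f n) (at x)" for n x
  have D: "(f n has_derivative D n x) (at x)" "D n x (c *s v) = c * D n x v"
    if "x \<in> S" for n x c v
    unfolding D_def using frechet_derivative_complex[OF dif[OF S_in[OF that]]] .
  have cauchy: "\<exists>N. \<forall>m\<ge>N. \<forall>n\<ge>N. \<forall>x\<in>S. \<forall>v. norm (D m x v - D n x v) \<le> e * norm v"
    if e: "e > 0" for e
  proof -
    \<comment> \<open>Two errors of this size bound the difference by \<open>e * r / 4\<close>, and
      the Cauchy estimate on a ball of radius \<open>r / 2\<close> multiplies this by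
      \<open>4 / r\<close>.\<close>
    have "e * r / 8 > 0"
      using e r by simp
    with lim obtain N where N: "\<And>n w. n \<ge> N \<Longrightarrow> w \<in> ball z r \<Longrightarrow> dist (f n w) (h w) < e * r / 8"
      unfolding uniform_limit_sequentially_iff by blast
    have "norm (D m x v - D n x v) \<le> e * norm v" if "m \<ge> N" "n \<ge> N" and x: "x \<in> S" for m n x v
    proof -
      have "norm (D m x v - D n x v) \<le> 2 * (e * r / 4) / (r / 2) * norm v"
      proof (rule Cauchy_estimate_vec[where f = "\<lambda>w. f m w - f n w"])
        show "complex_differentiable_at (\<lambda>w. f m w - f n w) w" if "w \<in> ball x (r / 2)" for w
          using dif S[OF x] that by (intro complex_differentiable_at_diff) auto
        show "norm (f m w - f n w) \<le> e * r / 4" if "w \<in> ball x (r / 2)" for w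
        proof -
          have "w \<in> ball z r"
            using S[OF x] that by blast
          then have "dist (f m w) (h w) < e * r / 8" "dist (f n w) (h w) < e * r / 8"
            using N \<open>m \<ge> N\<close> \<open>n \<ge> N\<close> by blast+
          then show ?thesis
            using dist_triangle2[of "f m w" "f n w" "h w"] by (simp add: dist_norm)
        qed
      qed (use r D[OF x] in \<open>auto intro: has_derivative_diff simp: algebra_simps\<close>)
      then show ?thesis
        using r by simp
    qed
    then show ?thesis
      by blast
  qed
  have "convergent (\<lambda>n. D n x v)" if "x \<in> S" for x v
  proof (rule Cauchy_convergent, rule metric_CauchyI)
    fix e :: real
    assume e: "e > 0"
    \<comment> \<open>The added 1 admits \<open>v = 0\<close> and makes the final inequality
      strict.\<close>
    define e' where "e' = e / (norm v + 1)"
    have "norm v + 1 > 0"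
      by (simp add: add_nonneg_pos)
    then have e': "e' > 0" "e' * norm v < e"
      using e by (auto simp: e'_def field_simps)
    from cauchy[OF e'(1)] obtain N where
      N: "\<forall>m\<ge>N. \<forall>n\<ge>N. \<forall>x\<in>S. \<forall>v. norm (D m x v - D n x v) \<le> e' * norm v" ..
    have "dist (D m x v) (D n x v) < e" if "m \<ge> N" "n \<ge> N" for m n
    proof -
      have "norm (D m x v - D n x v) \<le> e' * norm v"
        using N that \<open>x \<in> S\<close> by blast
      with e'(2) show ?thesis
        by (simp add: dist_norm)
    qed
    then show "\<exists>N. \<forall>m\<ge>N. \<forall>n\<ge>N. dist (D m x v) (D n x v) < e"
      by blast
  qed
  then obtain D' where D': "\<And>x v. x \<in> S \<Longrightarrow> (\<lambda>n. D n x v) \<longlonglongrightarrow> D' x v"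
    unfolding convergent_def by metis
  have zS: "z \<in> S"
    using r by (simp add: S_def)
  have ptw: "(\<lambda>n. f n x) \<longlonglongrightarrow> h x" if "x \<in> S" for x
    using tendsto_uniform_limitI[OF lim S_in[OF that]] .
  have "\<exists>g. \<forall>x\<in>S. (\<lambda>n. f n x) \<longlonglongrightarrow> g x \<and> (g has_derivative D' x) (at x within S)"
  proof (rule has_derivative_sequence)
    show "convex S"
      by (simp add: S_def)
    show "(f n has_derivative D n x) (at x within S)" if "x \<in> S" for n x
      using D(1)[OF that] by (rule has_derivative_at_withinI)
    show "\<forall>\<^sub>F n in sequentially. \<forall>x\<in>S. \<forall>v. norm (D n x v - D' x v) \<le> e * norm v"
      if "e > 0" for e
    proof -
      from cauchy[OF that] obtain N where
        N: "\<And>m n x v. m \<ge> N \<Longrightarrow> n \<ge> N \<Longrightarrow> x \<in> S \<Longrightarrow> norm (D m x v - D n x v) \<le> e * norm v"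
        by blast
      have "norm (D n x v - D' x v) \<le> e * norm v" if "n \<ge> N" "x \<in> S" for n x v
      proof (rule tendsto_upperbound)
        show "(\<lambda>m. norm (D n x v - D m x v)) \<longlonglongrightarrow> norm (D n x v - D' x v)"
          by (intro tendsto_intros D' that)
        show "\<forall>\<^sub>F m in sequentially. norm (D n x v - D m x v) \<le> e * norm v"
          using N that unfolding eventually_sequentially by blast
      qed simp
      then show ?thesis
        unfolding eventually_sequentially by blast
    qed
  qed (use zS ptw in auto)
  then obtain g where g: "\<And>x. x \<in> S \<Longrightarrow> (\<lambda>n. f n x) \<longlonglongrightarrow> g x"
    "\<And>x. x \<in> S \<Longrightarrow> (g has_derivative D' x) (at x within S)"
    by blast
  have "(g has_derivative D' z) (at z)"
    using g(2)[OF zS] zS by (simp add: S_def at_within_open[of z "ball z (r / 2)"])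
  \<comment> \<open>Termwise differentiation only yields some limit function \<open>g\<close>;
    uniqueness of pointwise limits identifies it with \<open>h\<close> on \<open>S\<close>.\<close>
  moreover have "g x = h x" if "x \<in> S" for x
    using LIMSEQ_unique g(1) ptw that by blast
  ultimately have "(h has_derivative D' z) (at z)"
    using has_derivative_transform_within_open[of g "D' z" z UNIV S h] zS by (simp add: S_def)
  moreover have "D' z (c *s v) = c * D' z v" for c v
  proof (rule LIMSEQ_unique)
    show "(\<lambda>n. D n z (c *s v)) \<longlonglongrightarrow> D' z (c *s v)"
      by (rule D'[OF zS])
    show "(\<lambda>n. D n z (c *s v)) \<longlonglongrightarrow> c * D' z v"
      by (simp add: D(2)[OF zS] tendsto_mult_left D'[OF zS])
  qed
  ultimately show ?thesis
    unfolding complex_differentiable_at_def by blast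
qed

text \<open>Cauchy's estimate on balls of radius \<open>r / 2\<close> bounds the derivative on the
  convex half ball, and the mean value inequality follows. The Lipschitz constant depends on
  \<open>M\<close> and \<open>r\<close> alone, which is what gives uniformity on noncompact
  tubes.\<close>

lemma dist_le_of_bounded_on_ball:
  fixes f :: "complex ^ 'n \<Rightarrow> complex"
  assumes r: "0 < r" and dif: "\<And>w. w \<in> ball z r \<Longrightarrow> complex_differentiable_at f w"
    and M: "\<And>w. w \<in> ball z r \<Longrightarrow> norm (f w) \<le> M" and w: "dist z w < r / 2"
  shows "dist (f z) (f w) \<le> 4 * M / r * dist z w"
proof -
  define S where "S = ball z (r / 2)"
  have S: "ball x (r / 2) \<subseteq> ball z r" if "x \<in> S" for x
    using that by (simp add: S_def dist_commute ball_subset_ball_iff)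
  have S_in: "x \<in> ball z r" if "x \<in> S" for x
    using that r by (simp add: S_def)
  define D where "D x = frechet_derivative f (at x)" for x
  have D: "(f has_derivative D x) (at x)" "D x (c *s v) = c * D x v" if "x \<in> S" for x c v
    unfolding D_def using frechet_derivative_complex[OF dif[OF S_in[OF that]]] .
  have "norm (f z - f w) \<le> 4 * M / r * norm (z - w)"
  proof (rule differentiable_bound[where S = S and f' = D])
    show "convex S" "z \<in> S" "w \<in> S"
      using r w by (auto simp: S_def)
    show "(f has_derivative D x) (at x within S)" if "x \<in> S" for x
      using D(1)[OF that] by (rule has_derivative_at_withinI)
    show "onorm (D x) \<le> 4 * M / r" if "x \<in> S" for x
    proof (rule onorm_bound)
      have "norm (f z) \<le> M"
        using r by (intro M) simp
      then show "0 \<le> 4 * M / r"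
        using r norm_ge_zero[of "f z"] by (simp del: norm_ge_zero)
      show "norm (D x v) \<le> 4 * M / r * norm v" for v
      proof -
        have "norm (D x v) \<le> 2 * M / (r / 2) * norm v"
          using r dif M D[OF that] S[OF that]
          by (intro Cauchy_estimate_vec[where z = x and f = f]) auto
        then show ?thesis
          by simp
      qed
    qed
  qed
  then show ?thesis
    by (simp add: dist_norm)
qed

section \<open>Tubes and neighbourhoods of compact bases\<close>

definition Im_vec :: "complex ^ 'n \<Rightarrow> real ^ 'n" where
  "Im_vec z = (\<chi> j. Im (z $ j))"

lemma tube_iff: "z \<in> tube \<Omega> \<longleftrightarrow> Im_vec z \<in> \<Omega>"
proof
  assume "Im_vec z \<in> \<Omega>"
  moreover have "z = (\<chi> j. Complex ((\<chi> j. Re (z $ j)) $ j) (Im_vec z $ j))"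
    by (simp add: vec_eq_iff Im_vec_def)
  ultimately show "z \<in> tube \<Omega>"
    unfolding tube_def by blast
qed (auto simp: tube_def Im_vec_def)

lemma tube_mono: "A \<subseteq> B \<Longrightarrow> tube A \<subseteq> tube B"
  by (auto simp: tube_iff)

lemma dist_Im_vec_le: "dist (Im_vec z) (Im_vec w) \<le> dist z w"
  unfolding dist_vec_def
  by (rule L2_set_mono)
     (simp_all add: Im_vec_def dist_norm abs_Im_le_cmod flip: minus_complex.sel)

lemma compact_cball_nbhd:
  fixes \<Omega> :: "'a::euclidean_space set"
  assumes "open \<Omega>" "compact K" "K \<subseteq> \<Omega>"
  obtains L r where "compact L" "L \<subseteq> \<Omega>" "0 < r" "\<And>x. x \<in> K \<Longrightarrow> cball x r \<subseteq> L"
proof -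
  obtain r where r: "r > 0" "(\<Union>x\<in>K. cball x r) \<subseteq> \<Omega>"
    using compact_subset_open_imp_cball_epsilon_subset assms by metis
  \<comment> \<open>The closed neighbourhood is the Minkowski sum of two compact sets, hence
    compact.\<close>
  have "(\<Union>x\<in>K. cball x r) = (\<Union>x\<in>K. \<Union>y\<in>cball 0 r. {x + y})"
    by (force simp: dist_norm norm_minus_commute intro: exI[where x = "_ - _"])
  then have "compact (\<Union>x\<in>K. cball x r)"
    using compact_sums'[OF assms(2) compact_cball] by simp
  with r that show thesis
    by blast
qed

text \<open>Taking imaginary parts does not increase distances, so a radius that works on the
  compact base works at every point of the tube.\<close>

lemma tube_cball_nbhd:
  assumes "open \<Omega>" "compact K" "K \<subseteq> \<Omega>"
  obtains L r where "compact L" "L \<subseteq> \<Omega>" "0 < r"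
    "\<And>z. z \<in> tube K \<Longrightarrow> cball z r \<subseteq> tube L"
proof -
  obtain L r where L: "compact L" "L \<subseteq> \<Omega>" "0 < r" "\<And>x. x \<in> K \<Longrightarrow> cball x r \<subseteq> L"
    by (rule compact_cball_nbhd[OF assms]) blast
  have "cball z r \<subseteq> tube L" if "z \<in> tube K" for z
  proof
    fix w
    assume "w \<in> cball z r"
    then have "Im_vec w \<in> cball (Im_vec z) r"
      using dist_Im_vec_le[of z w] by simp
    with L(4) that show "w \<in> tube L"
      unfolding tube_iff by blast
  qed
  with L that show thesis
    by blast
qed

text \<open>The tube topology tests connected subdomains, while the estimates use compact sets.
  Convexity of \<open>\<Omega>\<close> links the two: the convex hull of a compact neighbourhood of
  \<open>K\<close> is compact, remains in \<open>\<Omega>\<close>, and has a convex interior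
  containing \<open>K\<close>.\<close>

lemma convex_domain_nbhd:
  fixes \<Omega> :: "'a::euclidean_space set"
  assumes "open \<Omega>" "convex \<Omega>" "compact K" "K \<subseteq> \<Omega>"
  obtains \<Omega>' where "open \<Omega>'" "connected \<Omega>'" "relatively_compactin (top_of_set \<Omega>) \<Omega>'" "K \<subseteq> \<Omega>'"
proof -
  obtain L r where L: "compact L" "L \<subseteq> \<Omega>" "0 < r" "\<And>x. x \<in> K \<Longrightarrow> cball x r \<subseteq> L"
    by (rule compact_cball_nbhd[OF assms(1,3,4)]) blast
  define H where "H = convex hull L"
  have H: "compact H" "H \<subseteq> \<Omega>" "convex H"
    using L assms(2) by (simp_all add: H_def compact_convex_hull hull_minimal)
  have int: "interior H \<subseteq> \<Omega>"
    using interior_subset H(2) by (rule subset_trans)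
  have "closedin (top_of_set \<Omega>) H"
    using H(1,2) by (simp add: closed_subset compact_imp_closed)
  then have "top_of_set \<Omega> closure_of interior H \<subseteq> H"
    by (rule closure_of_minimal[OF interior_subset])
  moreover have "compactin (top_of_set \<Omega>) H"
    using H(1,2) by (simp add: compactin_subtopology)
  ultimately have "compactin (top_of_set \<Omega>) (top_of_set \<Omega> closure_of interior H)"
    using closed_compactin[OF _ _ closedin_closure_of] by metis
  then have "relatively_compactin (top_of_set \<Omega>) (interior H)"
    using int by (simp add: relatively_compactin_def)
  moreover have "K \<subseteq> interior H"
  proof
    fix x
    assume "x \<in> K"
    then have "ball x r \<subseteq> H"
      unfolding H_def using L(4) hull_subset[of L convex] ball_subset_cball by blast
    with L(3) show "x \<in> interior H"
      unfolding mem_interior by blast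
  qed
  ultimately show thesis
    using H(3) by (intro that[of "interior H"]) (simp_all add: convex_connected convex_interior)
qed

lemma relatively_compactin_top_of_set:
  assumes "relatively_compactin (top_of_set S) A"
  obtains K where "compact K" "K \<subseteq> S" "A \<subseteq> K"
  using assms that closure_of_subset[of A "top_of_set S"]
  by (auto simp: relatively_compactin_def compactin_subtopology)

section \<open>Relative compactness of indexed families as total boundedness\<close>

lemma (in Metric_space) mtotally_bounded_range_iff:
  assumes "range \<phi> \<subseteq> M"
  shows "mtotally_bounded (range \<phi>) \<longleftrightarrow>
    (\<forall>\<epsilon>>0. \<exists>F. finite F \<and> (\<forall>s. \<exists>s'\<in>F. d (\<phi> s) (\<phi> s') < \<epsilon>))"
proof
  assume L: "mtotally_bounded (range \<phi>)"
  show "\<forall>\<epsilon>>0. \<exists>F. finite F \<and> (\<forall>s. \<exists>s'\<in>F. d (\<phi> s) (\<phi> s') < \<epsilon>)"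
  proof (intro allI impI)
    fix \<epsilon> :: real
    assume "\<epsilon> > 0"
    with L have "\<exists>K. finite K \<and> K \<subseteq> range \<phi> \<and> range \<phi> \<subseteq> (\<Union>x\<in>K. mball x \<epsilon>)"
      unfolding mtotally_bounded_def by simp
    then obtain K where K: "finite K" "K \<subseteq> range \<phi>" "range \<phi> \<subseteq> (\<Union>x\<in>K. mball x \<epsilon>)"
      by (elim exE conjE)
    obtain F where F: "finite F" "K = \<phi> ` F"
      using finite_subset_image[OF K(1,2)] by (elim exE conjE)
    have "\<exists>s'\<in>F. d (\<phi> s) (\<phi> s') < \<epsilon>" for s
    proof -
      have "\<phi> s \<in> (\<Union>x\<in>K. mball x \<epsilon>)"
        using K(3) by (rule subsetD) simp
      then show ?thesis
        unfolding F(2) by (auto simp: commute)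
    qed
    with F(1) show "\<exists>F. finite F \<and> (\<forall>s. \<exists>s'\<in>F. d (\<phi> s) (\<phi> s') < \<epsilon>)"
      by blast
  qed
next
  assume R: "\<forall>\<epsilon>>0. \<exists>F. finite F \<and> (\<forall>s. \<exists>s'\<in>F. d (\<phi> s) (\<phi> s') < \<epsilon>)"
  show "mtotally_bounded (range \<phi>)"
    unfolding mtotally_bounded_def
  proof (intro allI impI)
    fix \<epsilon> :: real
    assume "\<epsilon> > 0"
    with R obtain F where F: "finite F" "\<forall>s. \<exists>s'\<in>F. d (\<phi> s) (\<phi> s') < \<epsilon>"
      by meson
    have "\<phi> s \<in> (\<Union>x\<in>\<phi> ` F. mball x \<epsilon>)" for s
    proof -
      obtain s' where "s' \<in> F" "d (\<phi> s) (\<phi> s') < \<epsilon>"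
        using F(2) by blast
      with assms have "\<phi> s \<in> mball (\<phi> s') \<epsilon>"
        by (simp add: commute range_subsetD)
      with \<open>s' \<in> F\<close> show ?thesis
        by blast
    qed
    with F(1) show "\<exists>K. finite K \<and> K \<subseteq> range \<phi> \<and> range \<phi> \<subseteq> (\<Union>x\<in>K. mball x \<epsilon>)"
      by (intro exI[of _ "\<phi> ` F"]) (simp add: image_subset_iff image_mono)
  qed
qed

text \<open>Completeness makes relative compactness the same as total boundedness. The nets consist
  of indices, so that for translates they are finite sets of shifts; the criterion serves both for
  functions on tubes and for sequences on the lattice.\<close>

lemma (in Metric_space) relatively_compactin_range_iff:
  assumes "mcomplete" "range \<phi> \<subseteq> M"
  shows "relatively_compactin mtopology (range \<phi>) \<longleftrightarrow>
    (\<forall>\<epsilon>>0. \<exists>F. finite F \<and> (\<forall>s. \<exists>s'\<in>F. d (\<phi> s) (\<phi> s') < \<epsilon>))"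
  using mtotally_bounded_eq_compact_closure_of[OF assms(1), of "range \<phi>"]
    mtotally_bounded_range_iff[OF assms(2)] assms(2)
  by (simp add: relatively_compactin_def)

section \<open>A complete metric for uniform convergence on tubes\<close>

text \<open>The weight measures depth inside \<open>\<Omega>\<close>. By \<open>superlevel\<close>,
  closeness on the tube over one compact set makes the weighted distance small; by
  \<open>lower_bound\<close>, a small weighted distance gives closeness on the tube over any
  prescribed compact set.\<close>

locale exhaustion_weight =
  fixes \<Omega> :: "(real ^ 'n) set" and v :: "real ^ 'n \<Rightarrow> real"
  assumes open_domain: "open \<Omega>" and convex_domain: "convex \<Omega>"
    and nonneg: "0 \<le> v y" and le_one: "v y \<le> 1" and pos_iff: "0 < v y \<longleftrightarrow> y \<in> \<Omega>"
    and superlevel: "0 < c \<Longrightarrow> \<exists>K. compact K \<and> K \<subseteq> \<Omega> \<and> {y. c \<le> v y} \<subseteq> K"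
    and lower_bound: "compact K \<Longrightarrow> K \<subseteq> \<Omega> \<Longrightarrow> \<exists>c>0. \<forall>y\<in>K. c \<le> v y"
begin

text \<open>The weight keeps the supremum finite, although holomorphic functions may be at infinite
  distance on a tube; it vanishes outside the tube over \<open>\<Omega>\<close>, so that all \<open>z\<close> may be used.\<close>

definition tdist :: "(complex ^ 'n \<Rightarrow> complex) \<Rightarrow> (complex ^ 'n \<Rightarrow> complex) \<Rightarrow> real" where
  "tdist f g = (SUP z. min (v (Im_vec z)) (dist (f z) (g z)))"

text \<open>As \<open>v\<close> is at most 1, the supremum is finite and can be tested pointwise:
  each point either has small weight or sees close values.\<close>

lemma tdist_le_iff:
  "tdist f g \<le> a \<longleftrightarrow> (\<forall>z. v (Im_vec z) \<le> a \<or> dist (f z) (g z) \<le> a)"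
proof -
  have "bdd_above (range (\<lambda>z. min (v (Im_vec z)) (dist (f z) (g z))))"
    using le_one by (intro bdd_aboveI[of _ 1]) (auto simp: min_le_iff_disj)
  then show ?thesis
    unfolding tdist_def by (subst cSUP_le_iff) (auto simp: min_le_iff_disj)
qed

lemma tdist_nonneg: "0 \<le> tdist f g"
proof -
  have "min (v (Im_vec 0)) (dist (f 0) (g 0)) \<le> tdist f g"
    using tdist_le_iff[of f g "tdist f g"] by (auto simp: min_le_iff_disj)
  with nonneg[of "Im_vec 0"] show ?thesis
    by (simp add: min_def split: if_splits)
       (metis order_trans zero_le_dist)+
qed

text \<open>The truncation by the weight is inactive wherever the weight exceeds the
  distance.\<close>

lemma dist_le_tdist:
  assumes "tdist f g < v (Im_vec z)"
  shows "dist (f z) (g z) \<le> tdist f g"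
  using assms tdist_le_iff[of f g "tdist f g"] by (meson not_le order_refl)

sublocale M: Metric_space "holomorphic_funs (tube \<Omega>)" tdist
proof
  fix f g h :: "complex ^ 'n \<Rightarrow> complex"
  show "0 \<le> tdist f g"
    by (rule tdist_nonneg)
  show "tdist f g = tdist g f"
    by (simp add: tdist_def dist_commute)
  show "tdist f h \<le> tdist f g + tdist g h"
    unfolding tdist_le_iff
  proof (intro allI disjCI)
    fix z
    assume "\<not> dist (f z) (h z) \<le> tdist f g + tdist g h"
    \<comment> \<open>If one of the two legs violates its bound at \<open>z\<close>, the weight
      there is at most the distance belonging to that leg.\<close>
    then have "\<not> (dist (f z) (g z) \<le> tdist f g \<and> dist (g z) (h z) \<le> tdist g h)"
      using dist_triangle[of "f z" "h z" "g z"] by linarith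
    then have "v (Im_vec z) \<le> tdist f g \<or> v (Im_vec z) \<le> tdist g h"
      using dist_le_tdist by (meson not_le)
    then show "v (Im_vec z) \<le> tdist f g + tdist g h"
      using tdist_nonneg[of f g] tdist_nonneg[of g h] by linarith
  qed
  assume f: "f \<in> holomorphic_funs (tube \<Omega>)" and g: "g \<in> holomorphic_funs (tube \<Omega>)"
  show "tdist f g = 0 \<longleftrightarrow> f = g"
  proof
    assume 0: "tdist f g = 0"
    show "f = g"
    proof (rule extensionalityI[of _ "tube \<Omega>"])
      \<comment> \<open>Distance zero forces equality where the weight is positive, that is, on the
        tube; outside it both functions are \<open>undefined\<close>.\<close>
      show "f z = g z" if "z \<in> tube \<Omega>" for z
        using that dist_le_tdist[of f g z] 0 pos_iff by (simp add: tube_iff)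
    qed (use f g in \<open>simp_all add: holomorphic_funs_iff\<close>)
  next
    assume "f = g"
    then show "tdist f g = 0"
      using tdist_nonneg[of f g] tdist_le_iff[of f g 0] by simp
  qed
qed

text \<open>The pointwise limit is also the limit in \<open>tdist\<close>. Near each point of the
  tube the weight is bounded away from 0, so convergence there is locally uniform and the limit is
  holomorphic by Weierstrass' theorem.\<close>

lemma MCauchy_imp_limitin:
  assumes "M.MCauchy \<sigma>"
  shows "\<exists>h. limitin M.mtopology \<sigma> h sequentially"
proof -
  have \<sigma>: "\<sigma> n \<in> holomorphic_funs (tube \<Omega>)" for n
    using assms unfolding M.MCauchy_def by blast
  have cauchy: "\<exists>N. \<forall>n n'. N \<le> n \<longrightarrow> N \<le> n' \<longrightarrow> tdist (\<sigma> n) (\<sigma> n') < \<epsilon>" if "\<epsilon> > 0" for \<epsilon>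
    using assms that unfolding M.MCauchy_def by blast
  have conv: "convergent (\<lambda>n. \<sigma> n z)" if z: "z \<in> tube \<Omega>" for z
  proof (rule Cauchy_convergent, rule metric_CauchyI)
    fix e :: real
    assume e: "e > 0"
    \<comment> \<open>Below the weight at \<open>z\<close> the distance controls the values at
      \<open>z\<close> without truncation.\<close>
    have "min e (v (Im_vec z)) > 0"
      using z pos_iff e by (simp add: tube_iff)
    from cauchy[OF this] obtain N where
      N: "\<And>n n'. N \<le> n \<Longrightarrow> N \<le> n' \<Longrightarrow> tdist (\<sigma> n) (\<sigma> n') < min e (v (Im_vec z))"
      by blast
    have "dist (\<sigma> m z) (\<sigma> n z) < e" if "m \<ge> N" "n \<ge> N" for m n
      using N[OF that] dist_le_tdist[of "\<sigma> m" "\<sigma> n" z] by simp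
    then show "\<exists>N. \<forall>m\<ge>N. \<forall>n\<ge>N. dist (\<sigma> m z) (\<sigma> n z) < e"
      by blast
  qed
  define h where "h = restrict (\<lambda>z. lim (\<lambda>n. \<sigma> n z)) (tube \<Omega>)"
  have lim: "(\<lambda>n. \<sigma> n z) \<longlonglongrightarrow> h z" if "z \<in> tube \<Omega>" for z
    using conv[OF that] that by (simp add: h_def convergent_LIMSEQ_iff)
  have small: "\<exists>N. \<forall>n\<ge>N. tdist (\<sigma> n) h \<le> e" if e: "e > 0" for e
  proof -
    from cauchy[OF e] obtain N where
      N: "\<And>n n'. N \<le> n \<Longrightarrow> N \<le> n' \<Longrightarrow> tdist (\<sigma> n) (\<sigma> n') < e"
      by blast
    have "tdist (\<sigma> n) h \<le> e" if n: "n \<ge> N" for n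
      unfolding tdist_le_iff disj_imp
    proof (intro allI impI)
      fix z
      assume z: "\<not> v (Im_vec z) \<le> e"
      with e have "z \<in> tube \<Omega>"
        using pos_iff[of "Im_vec z"] by (simp add: tube_iff)
      show "dist (\<sigma> n z) (h z) \<le> e"
      proof (rule tendsto_upperbound)
        show "(\<lambda>m. dist (\<sigma> n z) (\<sigma> m z)) \<longlonglongrightarrow> dist (\<sigma> n z) (h z)"
          by (intro tendsto_intros lim \<open>z \<in> tube \<Omega>\<close>)
        have "dist (\<sigma> n z) (\<sigma> m z) \<le> e" if "m \<ge> N" for m
          using N[OF n that] dist_le_tdist[of "\<sigma> n" "\<sigma> m" z] z by linarith
        then show "\<forall>\<^sub>F m in sequentially. dist (\<sigma> n z) (\<sigma> m z) \<le> e"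
          unfolding eventually_sequentially by blast
      qed simp
    qed
    then show ?thesis
      by blast
  qed
  have "complex_differentiable_at h z" if z: "z \<in> tube \<Omega>" for z
  proof -
    obtain L r where L: "compact L" "L \<subseteq> \<Omega>" "0 < r" "\<And>w. w \<in> tube {Im_vec z} \<Longrightarrow> cball w r \<subseteq> tube L"
      using tube_cball_nbhd[OF open_domain, of "{Im_vec z}"] z by (auto simp: tube_iff)
    have ball: "ball z r \<subseteq> tube L"
      using L(4)[of z] ball_subset_cball[of z r] by (auto simp: tube_iff)
    obtain c where c: "c > 0" "\<And>y. y \<in> L \<Longrightarrow> c \<le> v y"
      using lower_bound[OF L(1,2)] by blast
    show ?thesis
    proof (rule complex_differentiable_at_uniform_limit)
      show "complex_differentiable_at (\<sigma> n) w" if "w \<in> ball z r" for n w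
      proof -
        have "w \<in> tube \<Omega>"
          using that ball tube_mono[OF L(2)] by blast
        with \<sigma>[of n] show ?thesis
          by (simp add: holomorphic_funs_iff)
      qed
      show "uniform_limit (ball z r) \<sigma> h sequentially"
      proof (rule uniform_limitI)
        fix e :: real
        assume e: "e > 0"
        \<comment> \<open>Half of \<open>c\<close> stays strictly below the weight on the ball, and
          half of \<open>e\<close> gives the strict inequality.\<close>
        with c(1) have "min c e / 2 > 0"
          by simp
        from small[OF this] obtain N where N: "\<And>n. n \<ge> N \<Longrightarrow> tdist (\<sigma> n) h \<le> min c e / 2"
          by blast
        have "dist (\<sigma> n w) (h w) < e" if "n \<ge> N" "w \<in> ball z r" for n w
        proof -
          have "c \<le> v (Im_vec w)"
            using that(2) ball c(2) by (auto simp: tube_iff)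
          with N[OF that(1)] c(1) e show ?thesis
            using dist_le_tdist[of "\<sigma> n" h w] by linarith
        qed
        then show "\<forall>\<^sub>F n in sequentially. \<forall>w\<in>ball z r. dist (\<sigma> n w) (h w) < e"
          unfolding eventually_sequentially by blast
      qed
    qed (fact L(3))
  qed
  then have "h \<in> holomorphic_funs (tube \<Omega>)"
    by (simp add: holomorphic_funs_iff h_def)
  moreover have "\<exists>N. \<forall>n\<ge>N. \<sigma> n \<in> holomorphic_funs (tube \<Omega>) \<and> tdist (\<sigma> n) h < e" if e: "e > 0" for e
  proof -
    have "e / 2 > 0"
      using e by simp
    from small[OF this] obtain N where "\<And>n. n \<ge> N \<Longrightarrow> tdist (\<sigma> n) h \<le> e / 2"
      by blast
    with e \<sigma> show ?thesis
      by (intro exI[of _ N]) (smt (verit) field_sum_of_halves)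
  qed
  ultimately have "limitin M.mtopology \<sigma> h sequentially"
    unfolding M.limit_metric_sequentially by blast
  then show ?thesis
    by blast
qed

lemma mcomplete: "M.mcomplete"
  unfolding M.mcomplete_def using MCauchy_imp_limitin by blast

text \<open>A supremum below \<epsilon> leaves a gap, and a perturbation that is uniformly smaller
  than the gap on the tube over \<open>\<Omega>'\<close> stays in the set.\<close>

lemma openin_mtopology_basic:
  assumes f: "f \<in> holomorphic_funs (tube \<Omega>)" and \<Omega>': "relatively_compactin (top_of_set \<Omega>) \<Omega>'"
  shows "openin M.mtopology
    {g \<in> holomorphic_funs (tube \<Omega>). (SUP z\<in>tube \<Omega>'. ereal (dist (f z) (g z))) < ereal \<epsilon>}"
    (is "openin _ ?B")
  unfolding M.openin_mtopology
proof (intro conjI allI impI)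
  obtain K where K: "compact K" "K \<subseteq> \<Omega>" "\<Omega>' \<subseteq> K"
    using relatively_compactin_top_of_set[OF \<Omega>'] .
  obtain c where c: "c > 0" "\<And>y. y \<in> K \<Longrightarrow> c \<le> v y"
    using lower_bound[OF K(1,2)] by blast
  fix g
  assume g: "g \<in> ?B"
  then obtain b where b: "(SUP z\<in>tube \<Omega>'. ereal (dist (f z) (g z))) < ereal b" "b < \<epsilon>"
    using ereal_dense2[of "SUP z\<in>tube \<Omega>'. ereal (dist (f z) (g z))" "ereal \<epsilon>"] by auto
  \<comment> \<open>The bound \<open>c\<close> removes the truncation over \<open>K\<close>; the
    bound \<open>\<epsilon> - b\<close> keeps \<open>b + r / 2\<close> below \<epsilon>.\<close>
  define r where "r = min c (\<epsilon> - b)"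
  have "h \<in> ?B" if h: "h \<in> M.mball g (r / 2)" for h
  proof -
    have "dist (f z) (h z) \<le> b + r / 2" if z: "z \<in> tube \<Omega>'" for z
    proof -
      have "ereal (dist (f z) (g z)) < ereal b"
        using SUP_upper[OF z] b(1) by (rule le_less_trans)
      moreover have "c \<le> v (Im_vec z)"
        using z K(3) c(2) by (auto simp: tube_iff)
      then have "dist (g z) (h z) \<le> r / 2"
        using dist_le_tdist[of g h z] h c(1) by (auto simp: r_def)
      ultimately show ?thesis
        using dist_triangle[of "f z" "h z" "g z"] by simp
    qed
    then have "(SUP z\<in>tube \<Omega>'. ereal (dist (f z) (h z))) \<le> ereal (b + r / 2)"
      by (intro SUP_least) simp
    also have "\<dots> < ereal \<epsilon>"
    proof -
      have "r \<le> \<epsilon> - b"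
        by (simp add: r_def)
      with b(2) have "b + r / 2 < \<epsilon>"
        by linarith
      then show ?thesis
        by simp
    qed
    finally show ?thesis
      using h by simp
  qed
  moreover have "r / 2 > 0"
    using c(1) b(2) by (simp add: r_def)
  ultimately show "\<exists>r>0. M.mball g r \<subseteq> ?B"
    by blast
qed auto

text \<open>Generating sets are metrically open. Conversely a metric ball of radius \<open>r\<close>
  contains the generating set for a connected neighbourhood of a compact set containing all points
  of weight at least \<open>r / 2\<close>, since elsewhere the weight itself keeps the truncated
  distance small.\<close>

lemma mtopology_eq: "M.mtopology = tube_topology \<Omega>"
proof (rule topology_eq[THEN iffD2], rule allI, rule iffI)
  fix U
  assume "openin (tube_topology \<Omega>) U"
  then show "openin M.mtopology U"
    unfolding tube_topology_def openin_topology_generated_by_iff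
  proof induction
    case (Basis s)
    then show ?case
      using openin_mtopology_basic by blast
  qed auto
next
  fix U
  assume U: "openin M.mtopology U"
  show "openin (tube_topology \<Omega>) U"
  proof (subst openin_subopen, rule ballI)
    fix f
    assume "f \<in> U"
    with U obtain r where r: "r > 0" "M.mball f r \<subseteq> U"
      unfolding M.openin_mtopology by blast
    from \<open>f \<in> U\<close> U have f: "f \<in> holomorphic_funs (tube \<Omega>)"
      unfolding M.openin_mtopology by blast
    from r(1) superlevel[of "r / 2"] obtain K where
      K: "compact K" "K \<subseteq> \<Omega>" "{y. r / 2 \<le> v y} \<subseteq> K"
      by auto
    obtain \<Omega>' where \<Omega>': "open \<Omega>'" "connected \<Omega>'" "relatively_compactin (top_of_set \<Omega>) \<Omega>'" "K \<subseteq> \<Omega>'"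
      using convex_domain_nbhd[OF open_domain convex_domain K(1,2)] .
    define B where "B = {g \<in> holomorphic_funs (tube \<Omega>).
      (SUP z\<in>tube \<Omega>'. ereal (dist (f z) (g z))) < ereal (r / 2)}"
    have "openin (tube_topology \<Omega>) B"
      unfolding tube_topology_def B_def
      by (rule topology_generated_by_Basis) (use f \<Omega>' r(1) in \<open>force intro: half_gt_zero\<close>)
    \<comment> \<open>Bounding the supremum by 0 also covers an empty tube, where it is minus
      infinity.\<close>
    moreover have "f \<in> B"
      using f r(1) by (auto simp: B_def intro!: le_less_trans[OF SUP_least[of _ _ 0]])
    moreover have "B \<subseteq> M.mball f r"
    proof
      fix g
      assume "g \<in> B"
      then have g: "g \<in> holomorphic_funs (tube \<Omega>)"
        and sup: "(SUP z\<in>tube \<Omega>'. ereal (dist (f z) (g z))) < ereal (r / 2)"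
        by (auto simp: B_def)
      have "dist (f z) (g z) \<le> r / 2" if "\<not> v (Im_vec z) \<le> r / 2" for z
      proof -
        have "Im_vec z \<in> {y. r / 2 \<le> v y}"
          using that by simp
        then have "z \<in> tube \<Omega>'"
          using K(3) \<Omega>'(4) tube_iff by blast
        from SUP_upper[OF this] sup have "ereal (dist (f z) (g z)) < ereal (r / 2)"
          by (rule le_less_trans)
        then show ?thesis
          by simp
      qed
      then have "tdist f g \<le> r / 2"
        unfolding tdist_le_iff by blast
      with f g r(1) show "g \<in> M.mball f r"
        by simp
    qed
    ultimately show "\<exists>T. openin (tube_topology \<Omega>) T \<and> f \<in> T \<and> T \<subseteq> U"
      using r(2) by blast
  qed
qed

text \<open>Total boundedness in \<open>tdist\<close>, rewritten by the two compactness properties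
  of the weight. The resulting criterion is free of the weight.\<close>

lemma relatively_compactin_tube_topology_iff:
  fixes \<phi> :: "'i \<Rightarrow> complex ^ 'n \<Rightarrow> complex"
  assumes "range \<phi> \<subseteq> holomorphic_funs (tube \<Omega>)"
  shows "relatively_compactin (tube_topology \<Omega>) (range \<phi>) \<longleftrightarrow>
    (\<forall>K \<epsilon>. compact K \<longrightarrow> K \<subseteq> \<Omega> \<longrightarrow> 0 < \<epsilon> \<longrightarrow>
      (\<exists>F. finite F \<and> (\<forall>s. \<exists>s'\<in>F. \<forall>z\<in>tube K. dist (\<phi> s z) (\<phi> s' z) \<le> \<epsilon>)))"
    (is "_ \<longleftrightarrow> ?R")
proof -
  have "relatively_compactin (tube_topology \<Omega>) (range \<phi>) \<longleftrightarrow>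
    (\<forall>\<epsilon>>0. \<exists>F. finite F \<and> (\<forall>s. \<exists>s'\<in>F. tdist (\<phi> s) (\<phi> s') < \<epsilon>))" (is "_ \<longleftrightarrow> ?L")
    unfolding mtopology_eq[symmetric] by (rule M.relatively_compactin_range_iff[OF mcomplete assms])
  also have "?L \<longleftrightarrow> ?R"
  proof
    assume L: ?L
    show ?R
    proof (intro allI impI)
      fix K and \<epsilon> :: real
      assume K: "compact K" "K \<subseteq> \<Omega>" and \<epsilon>: "0 < \<epsilon>"
      obtain c where c: "c > 0" "\<And>y. y \<in> K \<Longrightarrow> c \<le> v y"
        using lower_bound[OF K] by blast
      have "min c \<epsilon> > 0"
        using c(1) \<epsilon> by simp
      with L obtain F where F: "finite F" "\<And>s. \<exists>s'\<in>F. tdist (\<phi> s) (\<phi> s') < min c \<epsilon>"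
        by blast
      have "dist (f z) (g z) \<le> \<epsilon>" if "tdist f g < min c \<epsilon>" "z \<in> tube K" for f g z
      proof -
        have "c \<le> v (Im_vec z)"
          using c(2) that(2) by (simp add: tube_iff)
        with that(1) show ?thesis
          using dist_le_tdist[of f g z] by linarith
      qed
      with F show "\<exists>F. finite F \<and> (\<forall>s. \<exists>s'\<in>F. \<forall>z\<in>tube K. dist (\<phi> s z) (\<phi> s' z) \<le> \<epsilon>)"
        by meson
    qed
  next
    assume R: ?R
    show ?L
    proof (intro allI impI)
      fix \<epsilon> :: real
      assume \<epsilon>: "\<epsilon> > 0"
      from \<epsilon> superlevel[of "\<epsilon> / 2"] obtain K where
        K: "compact K" "K \<subseteq> \<Omega>" "{y. \<epsilon> / 2 \<le> v y} \<subseteq> K"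
        by auto
      from R[rule_format, OF K(1,2) half_gt_zero[OF \<epsilon>]] obtain F where
        F: "finite F" "\<forall>s. \<exists>s'\<in>F. \<forall>z\<in>tube K. dist (\<phi> s z) (\<phi> s' z) \<le> \<epsilon> / 2"
        by (elim exE conjE)
      have "tdist f g < \<epsilon>" if "\<forall>z\<in>tube K. dist (f z) (g z) \<le> \<epsilon> / 2" for f g
      proof -
        have "tdist f g \<le> \<epsilon> / 2"
          unfolding tdist_le_iff disj_imp
        proof (intro allI impI)
          fix z
          assume "\<not> v (Im_vec z) \<le> \<epsilon> / 2"
          then have "Im_vec z \<in> {y. \<epsilon> / 2 \<le> v y}"
            by simp
          then have "z \<in> tube K"
            using K(3) tube_iff by blast
          with that show "dist (f z) (g z) \<le> \<epsilon> / 2" ..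
        qed
        with \<epsilon> show ?thesis
          by simp
      qed
      with F show "\<exists>F. finite F \<and> (\<forall>s. \<exists>s'\<in>F. tdist (\<phi> s) (\<phi> s') < \<epsilon>)"
        by meson
    qed
  qed
  finally show ?thesis .
qed

end

text \<open>For a compact exhaustion \<open>C\<close>, the step function \<open>1 / (1 + k)\<close>
  works, where \<open>k\<close> is the first stage containing the point: a lower bound on the weight
  bounds the stage, and a compact set lies in a single stage.\<close>

lemma exhaustion_weight_exists:
  fixes \<Omega> :: "(real ^ 'n) set"
  assumes "open \<Omega>" "convex \<Omega>"
  shows "\<exists>v. exhaustion_weight \<Omega> v"
proof -
  obtain C where C: "\<And>n. compact (C n)" "\<And>n. C n \<subseteq> \<Omega>" "\<And>n. C n \<subseteq> interior (C (Suc n))"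
    "\<Union>(range C) = \<Omega>" "\<And>K. compact K \<Longrightarrow> K \<subseteq> \<Omega> \<Longrightarrow> \<exists>N. \<forall>n\<ge>N. K \<subseteq> C n"
    by (rule open_Union_compact_subsets[OF assms(1)]) (rule that)
  have mono: "C m \<subseteq> C n" if "m \<le> n" for m n
  proof -
    have "C n \<subseteq> C (Suc n)" for n
      using C(3) interior_subset by (rule subset_trans)
    with that show ?thesis
      by (simp add: lift_Suc_mono_le)
  qed
  \<comment> \<open>Outside \<open>\<Omega>\<close> no stage contains \<open>y\<close> and this
    value is arbitrary; \<open>v\<close> is set to 0 there.\<close>
  define k where "k y = (LEAST n. y \<in> C n)" for y
  have k: "y \<in> C (k y)" if "y \<in> \<Omega>" for y
    using that C(4) unfolding k_def by (metis LeastI UN_E)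
  define v where "v y = (if y \<in> \<Omega> then 1 / (1 + real (k y)) else 0)" for y
  have "exhaustion_weight \<Omega> v"
  proof
    show "\<exists>K. compact K \<and> K \<subseteq> \<Omega> \<and> {y. c \<le> v y} \<subseteq> K" if c: "0 < c" for c
    proof -
      obtain N where N: "1 / c \<le> real N"
        using real_arch_simple by blast
      have "y \<in> C N" if "c \<le> v y" for y
      proof -
        have y: "y \<in> \<Omega>" "c \<le> 1 / (1 + real (k y))"
          using that c by (auto simp: v_def split: if_splits)
        then have "1 + real (k y) \<le> 1 / c"
          using c by (simp add: field_simps)
        with N have "k y \<le> N"
          by linarith
        with k[OF y(1)] mono show ?thesis
          by blast
      qed
      with C(1,2) show ?thesis
        by (intro exI[of _ "C N"]) auto
    qed
    show "\<exists>c>0. \<forall>y\<in>K. c \<le> v y" if K: "compact K" "K \<subseteq> \<Omega>" for K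
    proof -
      obtain N where N: "K \<subseteq> C N"
        using C(5)[OF K] by blast
      have "1 / (1 + real N) \<le> v y" if "y \<in> K" for y
      proof -
        have "k y \<le> N"
          unfolding k_def using that N by (intro Least_le) blast
        then show ?thesis
          using that K(2) by (auto simp: v_def frac_le)
      qed
      then show ?thesis
        by (intro exI[of _ "1 / (1 + real N)"]) auto
    qed
  qed (use assms in \<open>auto simp: v_def\<close>)
  then show ?thesis
    by blast
qed

section \<open>Translations by real vectors and by periods\<close>

lemma linf_mspace_iff: "u \<in> Met_TC.fspace UNIV \<longleftrightarrow> bounded (range u)" for u :: "'i \<Rightarrow> complex"
  by (simp add: Met_TC.fspace_def)

text \<open>Bounded functions with the supremum norm form a complete space, so the total boundedness
  criterion applies to lattice translates.\<close>

lemma AP_Zn_iff: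
  fixes u :: "int ^ 'n \<Rightarrow> complex"
  shows "u \<in> AP_Zn \<longleftrightarrow> bounded (range u) \<and>
    (\<forall>\<epsilon>>0. \<exists>F. finite F \<and> (\<forall>s. \<exists>s'\<in>F. \<forall>t. dist (u (t + s)) (u (t + s')) \<le> \<epsilon>))"
proof (cases "bounded (range u)")
  case True
  interpret L: Metric_space "Met_TC.fspace (UNIV :: (int ^ 'n) set) :: (int ^ 'n \<Rightarrow> complex) set"
    "Met_TC.fdist (UNIV :: (int ^ 'n) set)"
    by (rule Met_TC.Metric_space_funspace)
  have "mcomplete_of (funspace (UNIV :: (int ^ 'n) set) (Met_TC.Self :: complex metric))"
    by (rule Met_TC.mcomplete_funspace) (simp add: complete_UNIV)
  then have complete: "L.mcomplete"
    by (simp add: mcomplete_of_def)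
  have \<phi>: "(\<lambda>t. u (t + s)) \<in> Met_TC.fspace UNIV" for s
    unfolding linf_mspace_iff using True by (rule bounded_subset) auto
  have fdist: "Met_TC.fdist UNIV (\<lambda>t. u (t + s)) (\<lambda>t. u (t + s')) \<le> a \<longleftrightarrow>
      (\<forall>t. dist (u (t + s)) (u (t + s')) \<le> a)" for s s' a
    using Met_TC.funspace_mdist_le[OF \<phi> \<phi>, of s s' a] by simp
  have "u \<in> AP_Zn \<longleftrightarrow> (\<forall>\<epsilon>>0. \<exists>F. finite F \<and> (\<forall>s. \<exists>s'\<in>F.
      Met_TC.fdist UNIV (\<lambda>t. u (t + s)) (\<lambda>t. u (t + s')) < \<epsilon>))"
    using L.relatively_compactin_range_iff[OF complete, of "\<lambda>s t. u (t + s)"] \<phi> True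
    by (simp add: AP_Zn_def linf_topology_def image_subset_iff)
  \<comment> \<open>A supremum corresponds exactly to a pointwise bound only for the weak
    inequality; passing to a smaller \<epsilon> recovers the strict one.\<close>
  also have "\<dots> \<longleftrightarrow> (\<forall>\<epsilon>>0. \<exists>F. finite F \<and> (\<forall>s. \<exists>s'\<in>F.
      Met_TC.fdist UNIV (\<lambda>t. u (t + s)) (\<lambda>t. u (t + s')) \<le> \<epsilon>))"
    by (meson dense less_imp_le order_le_less_trans)
  finally show ?thesis
    using True by (simp add: fdist)
qed (simp add: AP_Zn_def)

text \<open>Moves the centres \<open>c\<close> of a finite net into the index set of \<open>s\<close> itself.\<close>

lemma finite_representatives:
  assumes "finite F" "\<And>s. \<exists>c\<in>F. P s c"
  shows "\<exists>G. finite G \<and> (\<forall>s. \<exists>s'\<in>G. \<exists>c\<in>F. P s c \<and> P s' c)"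
proof (intro exI[of _ "(\<lambda>c. SOME s. P s c) ` F"] conjI allI)
  fix s
  obtain c where c: "c \<in> F" "P s c"
    using assms(2) by blast
  moreover have "P (SOME s. P s c) c"
    using c(2) by (rule someI)
  ultimately show "\<exists>s'\<in>(\<lambda>c. SOME s. P s c) ` F. \<exists>c\<in>F. P s c \<and> P s' c"
    by blast
qed (use assms(1) in simp)

section \<open>The period lattice and its cell\<close>

definition period :: "int ^ 'n \<Rightarrow> real ^ 'n" where
  "period m = (\<chi> j. 2 * pi * of_int (m $ j))"

text \<open>The box is closed to be compact; neighbouring translates share faces, and decompositions
  modulo periods are asked to exist, not to be unique.\<close>

definition period_cell :: "(real ^ 'n) set" where
  "period_cell = cbox 0 (\<chi> j. 2 * pi)"

definition Re_vec :: "complex ^ 'n \<Rightarrow> real ^ 'n" where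
  "Re_vec z = (\<chi> j. Re (z $ j))"

lemma deck_action_eq: "deck_action m z = real_shift (period m) z"
  by (simp add: deck_action_def real_shift_def period_def vec_eq_iff)

lemma period_add: "period (m + k) = period m + period k"
  by (simp add: period_def vec_eq_iff algebra_simps)

lemma real_shift_add: "real_shift s (real_shift t z) = real_shift (s + t) z"
  by (simp add: real_shift_def vec_eq_iff algebra_simps)

lemma real_shift_0 [simp]: "real_shift 0 z = z"
  by (simp add: real_shift_def vec_eq_iff)

lemma Im_vec_real_shift [simp]: "Im_vec (real_shift s z) = Im_vec z"
  by (simp add: Im_vec_def real_shift_def)

lemma Re_vec_real_shift: "Re_vec (real_shift s z) = s + Re_vec z"
  by (simp add: Re_vec_def real_shift_def vec_eq_iff)

lemma real_shift_in_tube [simp]: "real_shift s z \<in> tube \<Omega> \<longleftrightarrow> z \<in> tube \<Omega>"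
  by (simp add: tube_iff)

lemma dist_real_shift [simp]: "dist (real_shift s z) (real_shift s w) = dist z w"
  by (simp add: real_shift_def dist_vec_def)

lemma dist_real_shift_left [simp]: "dist (real_shift s z) (real_shift t z) = dist s t"
  by (simp add: real_shift_def dist_vec_def dist_norm flip: of_real_diff)

lemma period_decomposition:
  fixes s :: "real ^ 'n"
  obtains m q where "s = period m + q" "q \<in> period_cell"
proof (rule that)
  define m :: "int ^ 'n" where "m = (\<chi> j. \<lfloor>s $ j / (2 * pi)\<rfloor>)"
  show "s = period m + (s - period m)"
    by simp
  have "0 \<le> s $ j - 2 * pi * \<lfloor>s $ j / (2 * pi)\<rfloor>"
       "s $ j - 2 * pi * \<lfloor>s $ j / (2 * pi)\<rfloor> \<le> 2 * pi" for j
  proof -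
    have "2 * pi * \<lfloor>s $ j / (2 * pi)\<rfloor> \<le> 2 * pi * (s $ j / (2 * pi))"
         "2 * pi * (s $ j / (2 * pi)) \<le> 2 * pi * (\<lfloor>s $ j / (2 * pi)\<rfloor> + 1)"
      using floor_correct[of "s $ j / (2 * pi)"] by (intro mult_left_mono; simp)+
    then show "0 \<le> s $ j - 2 * pi * \<lfloor>s $ j / (2 * pi)\<rfloor>"
       "s $ j - 2 * pi * \<lfloor>s $ j / (2 * pi)\<rfloor> \<le> 2 * pi"
      by (simp_all add: distrib_left)
  qed
  then show "s - period m \<in> period_cell"
    by (simp add: period_cell_def mem_box_cart period_def m_def)
qed

lemma exp_covering_period: "exp_covering (real_shift (period m) z) = exp_covering z"
proof -
  have "exp (\<i> * (w + complex_of_real (2 * pi * of_int k))) = exp (\<i> * w)" for w k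
    using exp_integer_2pi[of "of_int k"]
    by (simp add: distrib_left exp_add mult_ac)
  then show ?thesis
    by (simp add: exp_covering_def real_shift_def period_def)
qed

text \<open>For compact \<open>K\<close> this is a compact set with the same image under
  \<open>exp_covering\<close> as the whole tube over \<open>K\<close>.\<close>

definition tube_cell :: "(real ^ 'n) set \<Rightarrow> (complex ^ 'n) set" where
  "tube_cell K = {z \<in> tube K. Re_vec z \<in> period_cell}"

lemma tube_cell_decomposition:
  assumes "z \<in> tube K"
  obtains m w where "w \<in> tube_cell K" "z = real_shift (period m) w"
proof -
  obtain m q where m: "Re_vec z = period m + q" "q \<in> period_cell"
    using period_decomposition by blast
  show thesis
  proof (rule that)
    show "z = real_shift (period m) (real_shift (- period m) z)"
      by (simp add: real_shift_add)
    show "real_shift (- period m) z \<in> tube_cell K"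
      using assms m by (simp add: tube_cell_def Re_vec_real_shift)
  qed
qed

lemma compact_tube_cell:
  assumes "compact K"
  shows "compact (tube_cell K)"
proof -
  have "tube_cell K = (\<lambda>(x, y). \<chi> j. Complex (x $ j) (y $ j)) ` (period_cell \<times> K)"
  proof (intro equalityI subsetI)
    fix z
    assume "z \<in> tube_cell K"
    moreover have "z = (\<lambda>(x, y). \<chi> j. Complex (x $ j) (y $ j)) (Re_vec z, Im_vec z)"
      by (simp add: Re_vec_def Im_vec_def vec_eq_iff)
    ultimately show "z \<in> (\<lambda>(x, y). \<chi> j. Complex (x $ j) (y $ j)) ` (period_cell \<times> K)"
      unfolding tube_cell_def tube_iff by blast
  qed (auto simp: tube_cell_def tube_iff Re_vec_def Im_vec_def)
  moreover have "continuous_on (period_cell \<times> K) (\<lambda>(x, y). \<chi> j. Complex (x $ j) (y $ j))"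
    unfolding case_prod_beta by (intro continuous_intros)
  moreover have "compact (period_cell \<times> K)"
    using assms by (intro compact_Times) (simp_all add: period_cell_def)
  ultimately show ?thesis
    using compact_continuous_image by (simp only:)
qed

lemma continuous_exp_covering: "continuous_on S exp_covering"
  unfolding exp_covering_def by (intro continuous_intros)

text \<open>Compact sets below the covering correspond to compact bases: the image of a tube over
  \<open>K\<close> is the image of its compact cell, and conversely the moduli of the coordinates
  below determine the imaginary part above.\<close>

lemma bounded_exp_covering_iff:
  fixes f :: "complex ^ 'n \<Rightarrow> complex"
  shows "(\<forall>U\<^sub>0. relatively_compactin (top_of_set (exp_covering ` tube \<Omega>)) U\<^sub>0 \<longrightarrow>
      bounded (f ` {z \<in> tube \<Omega>. exp_covering z \<in> U\<^sub>0})) \<longleftrightarrow>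
    (\<forall>K. compact K \<longrightarrow> K \<subseteq> \<Omega> \<longrightarrow> bounded (f ` tube K))"
    (is "?L \<longleftrightarrow> ?R")
proof
  assume L: ?L
  show ?R
  proof (intro allI impI)
    fix K
    assume K: "compact K" "K \<subseteq> \<Omega>"
    define U where "U = exp_covering ` tube_cell K"
    have U: "compact U" "U \<subseteq> exp_covering ` tube \<Omega>"
      using compact_continuous_image[OF continuous_exp_covering compact_tube_cell[OF K(1)]]
        tube_mono[OF K(2)] by (auto simp: U_def tube_cell_def)
    then have "top_of_set (exp_covering ` tube \<Omega>) closure_of U = U"
      by (simp add: closure_of_closedin closed_subset compact_imp_closed)
    with U have "relatively_compactin (top_of_set (exp_covering ` tube \<Omega>)) U"
      by (simp add: relatively_compactin_def compactin_subtopology)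
    with L have "bounded (f ` {z \<in> tube \<Omega>. exp_covering z \<in> U})"
      by blast
    moreover have "tube K \<subseteq> {z \<in> tube \<Omega>. exp_covering z \<in> U}"
    proof
      fix z
      assume z: "z \<in> tube K"
      obtain m w where "w \<in> tube_cell K" "z = real_shift (period m) w"
        using tube_cell_decomposition[OF z] .
      then have "exp_covering z \<in> U"
        by (simp add: U_def exp_covering_period)
      with z show "z \<in> {z \<in> tube \<Omega>. exp_covering z \<in> U}"
        using tube_mono[OF K(2)] by blast
    qed
    ultimately show "bounded (f ` tube K)"
      by (meson bounded_subset image_mono)
  qed
next
  assume R: ?R
  show ?L
  proof (intro allI impI)
    fix U
    assume "relatively_compactin (top_of_set (exp_covering ` tube \<Omega>)) U"
    then obtain C where C: "compact C" "C \<subseteq> exp_covering ` tube \<Omega>" "U \<subseteq> C"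
      by (rule relatively_compactin_top_of_set)
    \<comment> \<open>The modulus of \<open>exp (\<i> * z $ j)\<close> is the exponential of
      \<open>- Im (z $ j)\<close>.\<close>
    define h :: "complex ^ 'n \<Rightarrow> real ^ 'n" where "h w = (\<chi> j. - ln (norm (w $ j)))" for w
    have h: "h (exp_covering z) = Im_vec z" for z
      by (simp add: h_def exp_covering_def Im_vec_def vec_eq_iff)
    have "w $ j \<noteq> 0" if "w \<in> C" for w j
      using that C(2) by (auto simp: exp_covering_def)
    then have "continuous_on C h"
      unfolding h_def by (intro continuous_intros) auto
    with C(1) have "compact (h ` C)"
      by (rule compact_continuous_image[rotated])
    moreover have "h ` C \<subseteq> \<Omega>"
    proof
      fix y
      assume "y \<in> h ` C"
      with C(2) obtain z where "z \<in> tube \<Omega>" "y = h (exp_covering z)"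
        by blast
      then show "y \<in> \<Omega>"
        by (simp add: h tube_iff)
    qed
    ultimately have "bounded (f ` tube (h ` C))"
      using R by blast
    moreover have "{z \<in> tube \<Omega>. exp_covering z \<in> U} \<subseteq> tube (h ` C)"
    proof
      fix z
      assume "z \<in> {z \<in> tube \<Omega>. exp_covering z \<in> U}"
      with C(3) have "h (exp_covering z) \<in> h ` C"
        by blast
      then show "z \<in> tube (h ` C)"
        by (simp add: h tube_iff)
    qed
    ultimately show "bounded (f ` {z \<in> tube \<Omega>. exp_covering z \<in> U})"
      by (meson bounded_subset image_mono)
  qed
qed

lemma open_tube:
  fixes \<Omega> :: "(real ^ 'n) set"
  assumes "open \<Omega>"
  shows "open (tube \<Omega>)"
proof -
  have "continuous_on UNIV (Im_vec :: complex ^ 'n \<Rightarrow> _)"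
    unfolding Im_vec_def by (intro continuous_intros)
  moreover have "tube \<Omega> = Im_vec -` \<Omega>"
    by (auto simp: tube_iff)
  ultimately show ?thesis
    using assms by (simp add: open_vimage)
qed

lemma holomorphic_funs_real_shift:
  assumes "open \<Omega>" "f \<in> holomorphic_funs (tube \<Omega>)"
  shows "restrict (\<lambda>z. f (real_shift s z)) (tube \<Omega>) \<in> holomorphic_funs (tube \<Omega>)"
proof -
  have "complex_differentiable_at (restrict (\<lambda>z. f (real_shift s z)) (tube \<Omega>)) z"
    if z: "z \<in> tube \<Omega>" for z
  proof -
    have "complex_differentiable_at f (real_shift s z)"
      using assms(2) z by (simp add: holomorphic_funs_iff)
    then obtain D where D: "(f has_derivative D) (at (real_shift s z))" "\<forall>c v. D (c *s v) = c * D v"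
      unfolding complex_differentiable_at_def by blast
    \<comment> \<open>The shift is addition of this constant vector, so the derivative
      \<open>D\<close> transfers unchanged and remains complex linear.\<close>
    define a where "a = real_shift s 0"
    have a: "real_shift s = (\<lambda>z. a + z)"
      by (simp add: a_def real_shift_def fun_eq_iff vec_eq_iff)
    have "((\<lambda>z. f (a + z)) has_derivative D) (at z)"
      using has_derivative_compose[OF has_derivative_add[OF has_derivative_const has_derivative_ident], of f D a z UNIV] D(1)
      by (simp add: a)
    then have "(restrict (\<lambda>z. f (real_shift s z)) (tube \<Omega>) has_derivative D) (at z)"
      unfolding a
      by (rule has_derivative_transform_within_open[OF _ open_tube[OF assms(1)] z]) simp
    with D(2) show ?thesis
      unfolding complex_differentiable_at_def by blast
  qed
  then show ?thesis
    by (simp add: holomorphic_funs_iff)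
qed

text \<open>The working form of almost periodicity. The restriction of translates disappears because
  tubes over \<open>K\<close> lie in the tube over \<open>\<Omega>\<close>.\<close>

lemma holomorphic_almost_periodic_iff:
  assumes "open \<Omega>" "convex \<Omega>" "f \<in> holomorphic_funs (tube \<Omega>)"
  shows "holomorphic_almost_periodic \<Omega> f \<longleftrightarrow>
    (\<forall>K \<epsilon>. compact K \<longrightarrow> K \<subseteq> \<Omega> \<longrightarrow> 0 < \<epsilon> \<longrightarrow> (\<exists>F. finite F \<and>
      (\<forall>s. \<exists>s'\<in>F. \<forall>z\<in>tube K. dist (f (real_shift s z)) (f (real_shift s' z)) \<le> \<epsilon>)))"
    (is "_ \<longleftrightarrow> ?R")
proof -
  obtain v where "exhaustion_weight \<Omega> v"
    using exhaustion_weight_exists[OF assms(1,2)] by blast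
  then interpret exhaustion_weight \<Omega> v .
  define \<phi> where "\<phi> s = restrict (\<lambda>z. f (real_shift s z)) (tube \<Omega>)" for s
  have "holomorphic_almost_periodic \<Omega> f \<longleftrightarrow>
    (\<forall>K \<epsilon>. compact K \<longrightarrow> K \<subseteq> \<Omega> \<longrightarrow> 0 < \<epsilon> \<longrightarrow>
      (\<exists>F. finite F \<and> (\<forall>s. \<exists>s'\<in>F. \<forall>z\<in>tube K. dist (\<phi> s z) (\<phi> s' z) \<le> \<epsilon>)))"
    unfolding holomorphic_almost_periodic_def \<phi>_def
    using assms(3) holomorphic_funs_real_shift[OF assms(1,3)]
    by (subst relatively_compactin_tube_topology_iff) auto
  also have "\<dots> \<longleftrightarrow> ?R"
  proof -
    have "(\<forall>z\<in>tube K. dist (\<phi> s z) (\<phi> s' z) \<le> \<epsilon>) \<longleftrightarrow>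
      (\<forall>z\<in>tube K. dist (f (real_shift s z)) (f (real_shift s' z)) \<le> \<epsilon>)"
      if "K \<subseteq> \<Omega>" for K s s' \<epsilon>
      using tube_mono[OF that] by (auto simp: \<phi>_def)
    then show ?thesis
      by (simp cong: imp_cong)
  qed
  finally show ?thesis .
qed

lemma holomorphic_funs_imp_continuous_on:
  "f \<in> holomorphic_funs S \<Longrightarrow> continuous_on S f"
  by (intro continuous_at_imp_continuous_on)
     (auto simp: holomorphic_funs_def intro: has_derivative_continuous)

section \<open>Finite nets of translates\<close>

text \<open>Every point of the tube is a lattice translate of a cell point, and that translate can
  be exchanged for one of finitely many real shifts at the cost of 1. Finitely many shifted cells
  form a compact set, on which \<open>f\<close> is bounded.\<close>

lemma holomorphic_almost_periodic_bounded:
  assumes \<Omega>: "open \<Omega>" "convex \<Omega>" and f: "f \<in> holomorphic_funs (tube \<Omega>)"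
    and ap: "holomorphic_almost_periodic \<Omega> f" and K: "compact K" "K \<subseteq> \<Omega>"
  shows "bounded (f ` tube K)"
proof -
  obtain F where F: "finite F"
    "\<forall>s. \<exists>s'\<in>F. \<forall>z\<in>tube K. dist (f (real_shift s z)) (f (real_shift s' z)) \<le> 1"
    using ap[unfolded holomorphic_almost_periodic_iff[OF \<Omega> f], rule_format, OF K zero_less_one]
    by (elim exE conjE)
  define C where "C = (\<Union>s\<in>F. real_shift s ` tube_cell K)"
  have "continuous_on (tube_cell K) (real_shift s)" for s
    unfolding real_shift_def by (intro continuous_intros)
  then have "compact C"
    unfolding C_def using F(1) compact_tube_cell[OF K(1)]
    by (intro compact_UN compact_continuous_image) auto
  moreover have "C \<subseteq> tube \<Omega>"
    using tube_mono[OF K(2)] by (auto simp: C_def tube_cell_def)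
  ultimately have "bounded (f ` C)"
    using holomorphic_funs_imp_continuous_on[OF f] continuous_on_subset
      compact_continuous_image compact_imp_bounded by metis
  then obtain B where B: "\<And>w. w \<in> C \<Longrightarrow> norm (f w) \<le> B"
    unfolding bounded_iff by blast
  have "norm (f z) \<le> B + 1" if z: "z \<in> tube K" for z
  proof -
    obtain m w where w: "w \<in> tube_cell K" "z = real_shift (period m) w"
      using tube_cell_decomposition[OF z] .
    then have "w \<in> tube K"
      by (simp add: tube_cell_def)
    \<comment> \<open>The net is applied to the shift \<open>period m\<close> at \<open>w\<close>,
      whose value is \<open>f z\<close>.\<close>
    with F(2) w(2) obtain s where s: "s \<in> F" "dist (f z) (f (real_shift s w)) \<le> 1"
      by blast
    then have "norm (f (real_shift s w)) \<le> B"
      using w(1) by (intro B) (auto simp: C_def)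
    with s(2) show ?thesis
      using norm_triangle_sub[of "f z" "f (real_shift s w)"] by (simp add: dist_norm)
  qed
  then show ?thesis
    unfolding bounded_iff by blast
qed

text \<open>The orbit of \<open>z\<close> lies in the tube over the single point
  \<open>Im_vec z\<close>, so almost periodicity over this compact set suffices. The real shifts in
  the net need not be periods; replacing them by lattice representatives doubles the error.\<close>

lemma holomorphic_almost_periodic_imp_AP_Zn:
  fixes \<Omega> :: "(real ^ 'n) set"
  assumes \<Omega>: "open \<Omega>" "convex \<Omega>" and f: "f \<in> holomorphic_funs (tube \<Omega>)"
    and ap: "holomorphic_almost_periodic \<Omega> f" and z: "z \<in> tube \<Omega>"
  shows "(\<lambda>g. f (deck_action g z)) \<in> AP_Zn"
  unfolding AP_Zn_iff
proof (intro conjI allI impI)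
  have K: "compact {Im_vec z}" "{Im_vec z} \<subseteq> \<Omega>"
    using z by (simp_all add: tube_iff)
  have tube: "real_shift s z \<in> tube {Im_vec z}" for s
    by (simp add: tube_iff)
  show "bounded (range (\<lambda>g. f (deck_action g z)))"
    by (rule bounded_subset[OF holomorphic_almost_periodic_bounded[OF \<Omega> f ap K]])
       (use tube in \<open>auto simp: deck_action_eq\<close>)
  fix \<epsilon> :: real
  assume "\<epsilon> > 0"
  then have "\<epsilon> / 2 > 0"
    by simp
  from ap[unfolded holomorphic_almost_periodic_iff[OF \<Omega> f], rule_format, OF K this]
  obtain F where F: "finite F" "\<forall>s. \<exists>s'\<in>F. \<forall>w\<in>tube {Im_vec z}.
      dist (f (real_shift s w)) (f (real_shift s' w)) \<le> \<epsilon> / 2"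
    by (elim exE conjE)
  define P where "P k c \<longleftrightarrow> (\<forall>w\<in>tube {Im_vec z}.
    dist (f (real_shift (period k) w)) (f (real_shift c w)) \<le> \<epsilon> / 2)" for k :: "int ^ 'n" and c
  obtain G where G: "finite G" "\<forall>k. \<exists>k'\<in>G. \<exists>c\<in>F. P k c \<and> P k' c"
    using finite_representatives[of F P] F unfolding P_def by blast
  have "dist (f (deck_action (t + k) z)) (f (deck_action (t + k') z)) \<le> \<epsilon>"
    if "P k c" "P k' c" for t k k' c
  proof -
    define w where "w = real_shift (period t) z"
    have "dist (f (real_shift (period k) w)) (f (real_shift c w)) \<le> \<epsilon> / 2"
         "dist (f (real_shift (period k') w)) (f (real_shift c w)) \<le> \<epsilon> / 2"
      using that tube unfolding P_def w_def by blast+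
    then have "dist (f (real_shift (period k) w)) (f (real_shift (period k') w)) \<le> \<epsilon>"
      using dist_triangle2[of "f (real_shift (period k) w)" "f (real_shift (period k') w)"
        "f (real_shift c w)"] by linarith
    then show ?thesis
      by (simp add: deck_action_eq w_def real_shift_add period_add add.commute)
  qed
  with G show "\<exists>F. finite F \<and> (\<forall>s. \<exists>s'\<in>F. \<forall>t.
      dist (f (deck_action (t + s) z)) (f (deck_action (t + s') z)) \<le> \<epsilon>)"
    by meson
qed

text \<open>A compact enlargement of \<open>K\<close> supplies one radius and one bound for
  \<open>f\<close> valid around all points of the tube, hence a common Lipschitz constant.\<close>

lemma uniformly_continuous_on_tube:
  assumes \<Omega>: "open \<Omega>" and f: "f \<in> holomorphic_funs (tube \<Omega>)"
    and bounded: "\<And>K. compact K \<Longrightarrow> K \<subseteq> \<Omega> \<Longrightarrow> bounded (f ` tube K)"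
    and K: "compact K" "K \<subseteq> \<Omega>" and \<epsilon>: "\<epsilon> > 0"
  obtains \<delta> where "\<delta> > 0" "\<And>z w. z \<in> tube K \<Longrightarrow> dist z w < \<delta> \<Longrightarrow> dist (f z) (f w) \<le> \<epsilon>"
proof -
  obtain L r where L: "compact L" "L \<subseteq> \<Omega>" "0 < r" "\<And>z. z \<in> tube K \<Longrightarrow> cball z r \<subseteq> tube L"
    by (rule tube_cball_nbhd[OF \<Omega> K]) blast
  obtain M where M: "M > 0" "\<And>z. z \<in> tube L \<Longrightarrow> norm (f z) \<le> M"
    using bounded[OF L(1,2)] unfolding bounded_pos by blast
  \<comment> \<open>The first bound is the range of the Lipschitz estimate; the second makes its
    constant \<open>4 * M / r\<close> yield \<epsilon>.\<close>
  define \<delta> where "\<delta> = min (r / 2) (\<epsilon> * r / (4 * M))"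
  show thesis
  proof (rule that)
    show "\<delta> > 0"
      using L(3) M(1) \<epsilon> by (simp add: \<delta>_def)
    fix z w
    assume z: "z \<in> tube K" and w: "dist z w < \<delta>"
    have ball: "ball z r \<subseteq> tube L"
      using L(4)[OF z] ball_subset_cball by blast
    have "dist (f z) (f w) \<le> 4 * M / r * dist z w"
    proof (rule dist_le_of_bounded_on_ball)
      show "complex_differentiable_at f x" if "x \<in> ball z r" for x
      proof -
        have "x \<in> tube \<Omega>"
          using that ball tube_mono[OF L(2)] by blast
        with f show ?thesis
          by (simp add: holomorphic_funs_iff)
      qed
      show "norm (f x) \<le> M" if "x \<in> ball z r" for x
        using that ball by (intro M(2)) blast
    qed (use L(3) w in \<open>simp_all add: \<delta>_def\<close>)
    also have "\<dots> \<le> 4 * M / r * (\<epsilon> * r / (4 * M))"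
      using w L(3) M(1) by (intro mult_left_mono) (simp_all add: \<delta>_def)
    also have "\<dots> = \<epsilon>"
      using L(3) M(1) by simp
    finally show "dist (f z) (f w) \<le> \<epsilon>" .
  qed
qed

lemma finite_dist_net:
  fixes S :: "'a::metric_space set"
  assumes "compact S" "\<delta> > 0"
  obtains N where "finite N" "N \<subseteq> S" "\<And>x. x \<in> S \<Longrightarrow> \<exists>y\<in>N. dist x y < \<delta>"
proof -
  obtain N where "finite N" "N \<subseteq> S" "S \<subseteq> (\<Union>x\<in>N. ball x \<delta>)"
    using seq_compact_imp_totally_bounded[of S] assms
    by (metis compact_imp_seq_compact)
  then show thesis
    by (intro that[of N]) (auto simp: dist_commute subset_iff)
qed

text \<open>Almost periodicity on finitely many sampled orbits is made simultaneous by recording one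
  centre per sample point. There are finitely many such tuples, and shifts sharing a tuple are close
  on all sampled orbits, hence by uniform continuity on the whole tube.\<close>

lemma finite_lattice_net:
  fixes f :: "complex ^ 'n \<Rightarrow> complex"
  assumes \<Omega>: "open \<Omega>" and f: "f \<in> holomorphic_funs (tube \<Omega>)"
    and bounded: "\<And>K. compact K \<Longrightarrow> K \<subseteq> \<Omega> \<Longrightarrow> bounded (f ` tube K)"
    and AP: "\<And>z. z \<in> tube \<Omega> \<Longrightarrow> (\<lambda>g. f (deck_action g z)) \<in> AP_Zn"
    and K: "compact K" "K \<subseteq> \<Omega>" and \<epsilon>: "\<epsilon> > 0"
  obtains G where "finite G" "\<And>m. \<exists>m'\<in>G. \<forall>z\<in>tube K.
    dist (f (real_shift (period m) z)) (f (real_shift (period m') z)) \<le> \<epsilon>"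
proof -
  \<comment> \<open>Four legs: from \<open>z\<close> to a sampled orbit, from \<open>m\<close> to
    the common centre, from there to \<open>m'\<close>, and back to \<open>z\<close>.\<close>
  have "\<epsilon> / 4 > 0"
    using \<epsilon> by simp
  obtain \<delta> where \<delta>: "\<delta> > 0"
    "\<And>z w. z \<in> tube K \<Longrightarrow> dist z w < \<delta> \<Longrightarrow> dist (f z) (f w) \<le> \<epsilon> / 4"
    by (rule uniformly_continuous_on_tube[OF \<Omega> f bounded K \<open>\<epsilon> / 4 > 0\<close>]) blast+
  obtain J where J: "finite J" "J \<subseteq> tube_cell K" "\<And>x. x \<in> tube_cell K \<Longrightarrow> \<exists>y\<in>J. dist x y < \<delta>"
    by (rule finite_dist_net[OF compact_tube_cell[OF K(1)] \<delta>(1)]) blast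
  have "\<exists>F. finite F \<and> (\<forall>m. \<exists>m'\<in>F. \<forall>t. dist (f (deck_action (t + m) x))
      (f (deck_action (t + m') x)) \<le> \<epsilon> / 4)" if "x \<in> J" for x
  proof -
    have "x \<in> tube \<Omega>"
      using that J(2) tube_mono[OF K(2)] by (auto simp: tube_cell_def)
    from AP[OF this] show ?thesis
      unfolding AP_Zn_iff using \<open>\<epsilon> / 4 > 0\<close> by blast
  qed
  then obtain F where F: "\<And>x. x \<in> J \<Longrightarrow> finite (F x)" "\<And>x m. x \<in> J \<Longrightarrow> \<exists>m'\<in>F x. \<forall>t.
      dist (f (deck_action (t + m) x)) (f (deck_action (t + m') x)) \<le> \<epsilon> / 4"
    by metis
  define P where "P m c \<longleftrightarrow> (\<forall>x\<in>J. \<forall>t.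
      dist (f (deck_action (t + m) x)) (f (deck_action (t + c x) x)) \<le> \<epsilon> / 4)"
    for m :: "int ^ 'n" and c
  have "\<exists>c\<in>PiE J F. P m c" for m
  proof -
    have "\<forall>x\<in>J. \<exists>m'. m' \<in> F x \<and> (\<forall>t.
        dist (f (deck_action (t + m) x)) (f (deck_action (t + m') x)) \<le> \<epsilon> / 4)"
      using F(2) by blast
    from bchoice[OF this] obtain c where "\<forall>x\<in>J. c x \<in> F x \<and> (\<forall>t.
        dist (f (deck_action (t + m) x)) (f (deck_action (t + c x) x)) \<le> \<epsilon> / 4)" ..
    \<comment> \<open>\<open>PiE\<close> demands \<open>undefined\<close> outside \<open>J\<close>,
      so the choice function is restricted; \<open>P\<close> evaluates it on \<open>J\<close>
      alone.\<close>
    then show ?thesis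
      by (intro bexI[of _ "restrict c J"]) (auto simp: P_def)
  qed
  moreover have "finite (PiE J F)"
    using J(1) F(1) by (rule finite_PiE)
  ultimately obtain G where G: "finite G" "\<forall>m. \<exists>m'\<in>G. \<exists>c\<in>PiE J F. P m c \<and> P m' c"
    using finite_representatives[of "PiE J F" P] by blast
  have "dist (f (real_shift (period m) z)) (f (real_shift (period m') z)) \<le> \<epsilon>"
    if P: "P m c" "P m' c" and z: "z \<in> tube K" for m m' c z
  proof -
    obtain t w where w: "w \<in> tube_cell K" "z = real_shift (period t) w"
      using tube_cell_decomposition[OF z] .
    obtain x where x: "x \<in> J" "dist w x < \<delta>"
      using J(3)[OF w(1)] by blast
    \<comment> \<open>Lattice shifts are isometries preserving the tube, so closeness of
      \<open>w\<close> and \<open>x\<close> in the cell persists along their orbits, whatever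
      \<open>k\<close> is.\<close>
    have near: "dist (f (real_shift (period k) z)) (f (deck_action (t + k) x)) \<le> \<epsilon> / 4" for k
    proof -
      have "real_shift (period k) z = deck_action (t + k) w"
        by (simp add: w(2) deck_action_eq real_shift_add period_add add.commute)
      moreover have "dist (f (deck_action (t + k) w)) (f (deck_action (t + k) x)) \<le> \<epsilon> / 4"
        using w(1) x(2) by (intro \<delta>(2)) (simp_all add: deck_action_eq tube_cell_def)
      ultimately show ?thesis
        by simp
    qed
    have "dist (f (deck_action (t + m) x)) (f (deck_action (t + c x) x)) \<le> \<epsilon> / 4"
         "dist (f (deck_action (t + m') x)) (f (deck_action (t + c x) x)) \<le> \<epsilon> / 4"
      using P x(1) unfolding P_def by blast+
    with near[of m] near[of m'] show ?thesis
      by metric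
  qed
  with G that show thesis
    by meson
qed

text \<open>A real shift splits into a period and a cell vector. Uniform continuity moves the cell
  vector to a finite net, and the lattice net then replaces the period; sums of the two nets form a
  finite set of shifts.\<close>

lemma holomorphic_AP_imp_almost_periodic:
  fixes f :: "complex ^ 'n \<Rightarrow> complex"
  assumes \<Omega>: "open \<Omega>" "convex \<Omega>" and f: "f \<in> holomorphic_funs (tube \<Omega>)"
    and bounded: "\<And>K. compact K \<Longrightarrow> K \<subseteq> \<Omega> \<Longrightarrow> bounded (f ` tube K)"
    and AP: "\<And>z. z \<in> tube \<Omega> \<Longrightarrow> (\<lambda>g. f (deck_action g z)) \<in> AP_Zn"
  shows "holomorphic_almost_periodic \<Omega> f"
  unfolding holomorphic_almost_periodic_iff[OF \<Omega> f]
proof (intro allI impI)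
  fix K and \<epsilon> :: real
  assume K: "compact K" "K \<subseteq> \<Omega>" and "\<epsilon> > 0"
  then have \<epsilon>: "\<epsilon> / 2 > 0"
    by simp
  obtain \<delta> where \<delta>: "\<delta> > 0"
    "\<And>z w. z \<in> tube K \<Longrightarrow> dist z w < \<delta> \<Longrightarrow> dist (f z) (f w) \<le> \<epsilon> / 2"
    by (rule uniformly_continuous_on_tube[OF \<Omega>(1) f bounded K \<epsilon>]) blast+
  obtain N where N: "finite N" "\<And>q :: real ^ 'n. q \<in> period_cell \<Longrightarrow> \<exists>q'\<in>N. dist q q' < \<delta>"
    by (rule finite_dist_net[OF _ \<delta>(1), of period_cell]) (auto simp: period_cell_def)
  obtain G where G: "finite G" "\<And>m. \<exists>m'\<in>G. \<forall>z\<in>tube K.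
      dist (f (real_shift (period m) z)) (f (real_shift (period m') z)) \<le> \<epsilon> / 2"
    by (rule finite_lattice_net[OF \<Omega>(1) f bounded AP K \<epsilon>]) blast+
  show "\<exists>F. finite F \<and> (\<forall>s. \<exists>s'\<in>F. \<forall>z\<in>tube K.
      dist (f (real_shift s z)) (f (real_shift s' z)) \<le> \<epsilon>)"
  proof (intro exI[of _ "(\<lambda>(m, q). period m + q) ` (G \<times> N)"] conjI allI)
    fix s :: "real ^ 'n"
    obtain m q where s: "s = period m + q" "q \<in> period_cell"
      using period_decomposition .
    obtain q' where q': "q' \<in> N" "dist q q' < \<delta>"
      using N(2)[OF s(2)] by blast
    obtain m' where m': "m' \<in> G" "\<forall>z\<in>tube K.
        dist (f (real_shift (period m) z)) (f (real_shift (period m') z)) \<le> \<epsilon> / 2"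
      using G(2) by blast
    have "dist (f (real_shift s z)) (f (real_shift (period m' + q') z)) \<le> \<epsilon>"
      if z: "z \<in> tube K" for z
    proof -
      have "dist (f (real_shift s z)) (f (real_shift (period m + q') z)) \<le> \<epsilon> / 2"
        using z q'(2) by (intro \<delta>(2)) (simp_all add: s(1))
      \<comment> \<open>The tube is invariant under real shifts, so the lattice net may be used at
        \<open>real_shift q' z\<close>.\<close>
      moreover have "dist (f (real_shift (period m + q') z)) (f (real_shift (period m' + q') z)) \<le> \<epsilon> / 2"
        using m'(2)[rule_format, of "real_shift q' z"] z by (simp add: real_shift_add)
      ultimately show ?thesis
        by metric
    qed
    with q'(1) m'(1) show "\<exists>s'\<in>(\<lambda>(m, q). period m + q) ` (G \<times> N). \<forall>z\<in>tube K.
        dist (f (real_shift s z)) (f (real_shift s' z)) \<le> \<epsilon>"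
      by (intro bexI[of _ "period m' + q'"]) auto
  qed (use G(1) N(1) in simp)
qed

theorem theorem1p3:
  fixes \<Omega> :: "(real ^ 'n) set" and f :: "complex ^ 'n \<Rightarrow> complex"
  assumes "open \<Omega>" and "convex \<Omega>" and "f \<in> holomorphic_funs (tube \<Omega>)"
  shows "holomorphic_almost_periodic \<Omega> f \<longleftrightarrow> f \<in> holomorphic_AP \<Omega>"
  unfolding holomorphic_AP_def bounded_exp_covering_iff
  using assms holomorphic_almost_periodic_bounded[OF assms]
    holomorphic_almost_periodic_imp_AP_Zn[OF assms] holomorphic_AP_imp_almost_periodic[OF assms]
  by blast

end
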